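(* Let $P=P(p_1,p_2,p_3,p_4,p_5)$ be any pentatope in $\mathbb{R}^4$ with edge lengths $l_1,\dots,l_{10}$ (ordered as in the context). Let $A(R,T)$ be the $4\times 4$ matrix that compares $P$ with the regular pentatope of the same hypervolume (defined in the context), let $\lambda_1,\lambda_2,\lambda_3,\lambda_4$ be its eigenvalues, and let the quality of $P$ be $$\eta^{(2)} := \frac{\lambda_1+\lambda_2+\lambda_3+\lambda_4}{2\sqrt{\lambda_1^2+\lambda_2^2+\lambda_3^2+\lambda_4^2}}.$$ Then $$\eta^{(2)} = \frac{6\sum_{i=1}^{10} l_i^2}{\sqrt{\Theta\left(\{l_i^2\}_{i=1}^{10}\right)}},$$ where $$\begin{aligned} \Theta\left(\{l_i^2\}_{i=1}^{10}\right) ={}& 600(l_1^2-l_2^2)^2+900\,l_5^4+100\bigl(-2(l_1^2+l_2^2)+l_5^2\bigr)^2\\ &+75(l_1^2-l_2^2-3l_6^2+3l_8^2)^2+25\bigl(l_1^2+l_2^2-3l_3^2+l_5^2-3(l_6^2+l_8^2)\bigr)^2\\ &+25\bigl(l_1^2+l_2^2-6l_3^2-2l_5^2+3(l_6^2+l_8^2)\bigr)^2\\ &+45(l_1^2-l_2^2+l_6^2-4l_7^2-l_8^2+4l_9^2)^2\\ &+15(l_1^2+l_2^2+2l_3^2-8l_4^2-2l_5^2-l_6^2+4l_7^2-l_8^2+4l_9^2)^2\\ &+30(-l_1^2-l_2^2+l_3^2+2l_4^2-l_5^2+l_6^2+2l_7^2+l_8^2+2l_9^2-6l_{10}^2)^2\\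 &+9\bigl(l_1^2+l_2^2+l_3^2-4l_4^2+l_5^2+l_6^2-4l_7^2+l_8^2-4(l_9^2+l_{10}^2)\bigr)^2. \end{aligned}$$
   Context: A pentatope is a (non-degenerate) 4-simplex in $\mathbb{R}^4$ with vertices $p_1,\dots,p_5$; $v>0$ denotes its 4-dimensional volume. Write $d_{ij}=\|p_j-p_i\|^2$ for $1\le i<j\le5$. The edge lengths are ordered so that $(l_1^2,l_2^2,\dots,l_{10}^2)=(d_{12},d_{13},d_{14},d_{15},d_{23},d_{24},d_{25},d_{34},d_{35},d_{45})$. Quality measures similarity between $P$ and a regular pentatope $P_r(r_1,\dots,r_5)$ with the same hypervolume $v$. The edge length of $P_r$ is $a=(96v/\sqrt5)^{1/4}$, and its vertices are $r_1=(-a\sqrt3/2,0,0,0)$, $r_2=(0,-a/2,0,0)$, $r_3=(0,a/2,0,0)$, $r_4=(-a\sqrt3/6,0,a\sqrt6/3,0)$, $r_5=(-a\sqrt3/6,0,a\sqrt6/12,a\sqrt{10}/4)$. Define the $4\times4$ matrices (by columns) $R=[\,r_2-r_1,\ r_3-r_1,\ r_4-r_1,\ r_5-r_1\,]$ and $T=[\,p_2-p_1,\ p_3-p_1,\ p_4-p_1,\ p_5-p_1\,]$, and set $$A(R,T)=(R^{-1})^{T}\,T^{T}T\,R^{-1},$$ where the superscript $T$ denotes transpose. The quality $\eta^{(2)}$ is the ratio of the arithmetic mean to the root-mean-square of the eigenvalues of $A(R,T)$. *)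

theory Defs
  imports "HOL-Analysis.Analysis" "HOL-Computational_Algebra.Polynomial"
begin

text \<open>The five vertices of a pentatope are \<open>p 1, \<dots>, p 5\<close>; the values of \<open>p\<close> at other indices are
  irrelevant.\<close>

definition pentatope :: "(nat \<Rightarrow> real^4) \<Rightarrow> bool" where
  "pentatope p \<longleftrightarrow> inj_on p {1..5} \<and> \<not> affine_dependent (p ` {1..5})"

definition hypervolume :: "(nat \<Rightarrow> real^4) \<Rightarrow> real" where
  "hypervolume p = measure lebesgue (convex hull (p ` {1..5}))"

definition edge_length :: "(nat \<Rightarrow> real^4) \<Rightarrow> nat \<Rightarrow> real" where
  "edge_length p k =
     (let (i, j) = [(1,2), (1,3), (1,4), (1,5), (2,3), (2,4), (2,5), (3,4), (3,5), (4,5)] ! (k - 1)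
      in norm (p j - p i))"

text \<open>The regular pentatope with edge length \<open>a\<close>; a regular pentatope has hypervolume
  \<open>sqrt 5 / 96 * a ^ 4\<close>, whence the value of \<open>a\<close> in \<open>comparison_matrix\<close>.\<close>

definition regular_pentatope :: "real \<Rightarrow> nat \<Rightarrow> real^4" where
  "regular_pentatope a = (\<lambda>_. 0)
     (1 := vector [- a * sqrt 3 / 2, 0, 0, 0],
      2 := vector [0, - a / 2, 0, 0],
      3 := vector [0, a / 2, 0, 0],
      4 := vector [- a * sqrt 3 / 6, 0, a * sqrt 6 / 3, 0],
      5 := vector [- a * sqrt 3 / 6, 0, a * sqrt 6 / 12, a * sqrt 10 / 4])"

text \<open>\<open>vector\<close> lists the rows of a matrix, so the transpose has the listed vectors as columns.\<close>

definition edge_matrix :: "(nat \<Rightarrow> real^4) \<Rightarrow> real^4^4" where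
  "edge_matrix p = transpose (vector [p 2 - p 1, p 3 - p 1, p 4 - p 1, p 5 - p 1])"

definition comparison_matrix :: "(nat \<Rightarrow> real^4) \<Rightarrow> real^4^4" where
  "comparison_matrix p =
     (let a = root 4 (96 * hypervolume p / sqrt 5);
          R = edge_matrix (regular_pentatope a);
          T = edge_matrix p
      in transpose (matrix_inv R) ** transpose T ** T ** matrix_inv R)"

definition charpoly :: "'a::comm_ring_1^'n^'n \<Rightarrow> 'a poly" where
  "charpoly A = det (mat [:0, 1:] - map_matrix (\<lambda>c. [:c:]) A)"

text \<open>Real eigenvalues with algebraic multiplicity. A real symmetric matrix, such as
  \<open>comparison_matrix p\<close>, has all its eigenvalues in this multiset.\<close>

definition eigenvalues :: "real^'n^'n \<Rightarrow> real multiset" where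
  "eigenvalues A = proots (charpoly A)"

definition quality :: "(nat \<Rightarrow> real^4) \<Rightarrow> real" where
  "quality p =
     (let E = eigenvalues (comparison_matrix p)
      in (\<Sum>x\<in>#E. x) / (2 * sqrt (\<Sum>x\<in>#E. x\<^sup>2)))"

text \<open>The argument \<open>s\<close> of \<open>Theta\<close> is the family of \<^emph>\<open>squared\<close> edge lengths, so that
  \<open>l\<^sub>5 ^ 4\<close> becomes \<open>(s 5)\<^sup>2\<close>.\<close>

definition Theta :: "(nat \<Rightarrow> real) \<Rightarrow> real" where
  "Theta s =
     600 * (s 1 - s 2)\<^sup>2 + 900 * (s 5)\<^sup>2 + 100 * (- 2 * (s 1 + s 2) + s 5)\<^sup>2
     + 75 * (s 1 - s 2 - 3 * s 6 + 3 * s 8)\<^sup>2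
     + 25 * (s 1 + s 2 - 3 * s 3 + s 5 - 3 * (s 6 + s 8))\<^sup>2
     + 25 * (s 1 + s 2 - 6 * s 3 - 2 * s 5 + 3 * (s 6 + s 8))\<^sup>2
     + 45 * (s 1 - s 2 + s 6 - 4 * s 7 - s 8 + 4 * s 9)\<^sup>2
     + 15 * (s 1 + s 2 + 2 * s 3 - 8 * s 4 - 2 * s 5 - s 6 + 4 * s 7 - s 8 + 4 * s 9)\<^sup>2
     + 30 * (- s 1 - s 2 + s 3 + 2 * s 4 - s 5 + s 6 + 2 * s 7 + s 8 + 2 * s 9 - 6 * s 10)\<^sup>2
     + 9 * (s 1 + s 2 + s 3 - 4 * s 4 + s 5 + s 6 - 4 * s 7 + s 8 - 4 * (s 9 + s 10))\<^sup>2"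

end

theory Submission
  imports Defs
begin

text \<open>
  The quality only involves the first two power sums of the eigenvalues of the comparison matrix
  \<open>A\<close>, and for a real symmetric matrix these are \<open>trace A\<close> and \<open>trace (A ** A)\<close>
  (\<open>symmetric_matrix_eigenvalue_sums\<close>). Symmetry matters because the eigenvalues are the
  real roots of the characteristic polynomial: \<open>A\<close> is orthogonally diagonalizable, so
  no root is lost. The diagonalization comes from an orthonormal eigenbasis, whose vectors are found
  one after the other by maximizing the Rayleigh quotient.

  Traces are invariant under cyclic permutation, so with \<open>A = R\<^sup>-\<^sup>T G R\<^sup>-\<^sup>1\<close>, where \<open>G = T\<^sup>T T\<close>, the
  two traces depend on the regular pentatope only through \<open>(R\<^sup>T R)\<^sup>-\<^sup>1\<close>, the inverse of its Gram
  matrix. The Gram matrix is \<open>a\<^sup>2 / 2\<close> times \<open>I + J\<close>, where all entries of \<open>J\<close> are 1, and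
  since \<open>J\<^sup>2 = 4 J\<close> its inverse is \<open>2 / a\<^sup>2\<close> times \<open>B = I - J / 5\<close>. In particular, all
  the square roots in the coordinates of the regular pentatope disappear, and the factor \<open>2 / a\<^sup>2\<close>
  cancels in the quality, which is thus
  \<open>trace (B G) / (2 sqrt (trace (B G B G)))\<close>. The pentatope has positive
  hypervolume, so \<open>a\<close> is nonzero and \<open>R\<close> invertible.

  By polarization the entries of \<open>G\<close> are linear in the squared edge lengths. Expanding the
  traces yields a fifth of the sum of the squared edge lengths
  (\<open>trace_regular_gram_inverse_edge_gram\<close>) and \<open>Theta / 3600\<close> (\<open>Theta_eq_trace\<close>).
\<close>

section \<open>Orthonormal eigenbases of self-adjoint maps\<close>

text \<open>The maximum of \<open>x \<bullet> f x\<close> over the unit sphere of the invariant subspace is attained by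
  compactness, and a point where it is attained is an eigenvector.\<close>

lemma self_adjoint_eigenvector_exists:
  fixes f :: "'a::euclidean_space \<Rightarrow> 'a"
  assumes lin: "linear f" and sa: "\<And>x y. f x \<bullet> y = x \<bullet> f y"
    and S: "subspace S" and inv: "f ` S \<subseteq> S" and nz: "S \<noteq> {0}"
  obtains u c where "u \<in> S" "norm u = 1" "f u = c *\<^sub>R u"
proof -
  interpret linear f by fact
  let ?K = "S \<inter> sphere 0 1"
  obtain z where z: "z \<in> S" "z \<noteq> 0"
    using nz subspace_0[OF S] by auto
  have "(1 / norm z) *\<^sub>R z \<in> ?K"
    using z S by (auto simp: subspace_scale)
  then have "?K \<noteq> {}" by blast
  moreover have "compact ?K"
    using S by (intro closed_Int_compact closed_subspace) auto
  moreover have "continuous_on ?K (\<lambda>x. x \<bullet> f x)"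
    using lin by (intro continuous_intros linear_continuous_on linear_linear[THEN iffD2])
      (auto simp: linear_conv_bounded_linear)
  ultimately obtain u where u: "u \<in> ?K" and umax: "\<And>x. x \<in> ?K \<Longrightarrow> x \<bullet> f x \<le> u \<bullet> f u"
    using continuous_attains_sup[of ?K "\<lambda>x. x \<bullet> f x"] by blast
  define m where "m = u \<bullet> f u"
  have uS: "u \<in> S" and nu: "norm u = 1" using u by auto
  have rayleigh: "x \<bullet> f x \<le> m * (x \<bullet> x)" if "x \<in> S" for x
  proof (cases "x = 0")
    case False
    then have "(1 / norm x) *\<^sub>R x \<in> ?K"
      using that S by (auto simp: subspace_scale)
    from umax[OF this] have "(x \<bullet> f x) / (norm x)\<^sup>2 \<le> m"
      by (simp add: m_def scale power2_eq_square)
    then show ?thesis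
      using False by (simp add: field_simps dot_square_norm)
  qed (simp add: zero)
  define v where "v = f u - m *\<^sub>R u"
  have vS: "v \<in> S"
    using uS inv S by (auto simp: v_def subspace_diff subspace_scale)
  define c where "c = v \<bullet> f v - m * (v \<bullet> v)"
  \<comment> \<open>\<open>v\<close> is half the gradient of the Rayleigh quotient at \<open>u\<close>: moving from \<open>u\<close> in the
    direction of \<open>v\<close> would increase the quotient to first order unless \<open>v\<close> vanishes.\<close>
  have quad: "2 * t * (v \<bullet> v) + t\<^sup>2 * c \<le> 0" for t
  proof -
    have "u + t *\<^sub>R v \<in> S"
      using uS vS S by (simp add: subspace_add subspace_scale)
    note rayleigh[OF this]
    moreover have "u \<bullet> f v = v \<bullet> f u"
      by (metis inner_commute sa)
    then have "(u + t *\<^sub>R v) \<bullet> f (u + t *\<^sub>R v) = m + 2 * t * (v \<bullet> f u) + t\<^sup>2 * (v \<bullet> f v)"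
      by (simp add: add scale inner_add m_def power2_eq_square algebra_simps)
    moreover have "u \<bullet> u = 1"
      using nu by (simp add: dot_square_norm)
    then have "m * ((u + t *\<^sub>R v) \<bullet> (u + t *\<^sub>R v)) =
        m + 2 * t * (m * (v \<bullet> u)) + t\<^sup>2 * (m * (v \<bullet> v))"
      by (simp add: inner_add inner_commute[of u v] power2_eq_square algebra_simps)
    moreover have "v \<bullet> v = v \<bullet> f u - m * (v \<bullet> u)"
      by (subst (2) v_def) (simp add: inner_diff_right)
    then have "2 * t * (v \<bullet> v) = 2 * t * (v \<bullet> f u) - 2 * t * (m * (v \<bullet> u))"
      by (simp only: right_diff_distrib)
    moreover have "t\<^sup>2 * c = t\<^sup>2 * (v \<bullet> f v) - t\<^sup>2 * (m * (v \<bullet> v))"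
      by (simp add: c_def algebra_simps)
    ultimately show ?thesis
      by linarith
  qed
  have "v = 0"
  proof (rule ccontr)
    assume "v \<noteq> 0"
    then have w: "v \<bullet> v > 0" by simp
    \<comment> \<open>a step so short that the quadratic term cannot outweigh the linear one\<close>
    define t where "t = (v \<bullet> v) / (\<bar>c\<bar> + 1)"
    have t: "t > 0" using w by (simp add: t_def add_nonneg_pos)
    have "t * (2 * (v \<bullet> v) + t * c) \<le> 0"
      using quad[of t] by (simp add: power2_eq_square algebra_simps)
    then have "2 * (v \<bullet> v) + t * c \<le> 0"
      using t by (simp add: mult_le_0_iff)
    moreover have "- (t * c) \<le> t * (\<bar>c\<bar> + 1)"
      using mult_left_mono[of "- c" "\<bar>c\<bar> + 1" t] t by simp
    moreover have "t * (\<bar>c\<bar> + 1) = v \<bullet> v"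
      by (simp add: t_def add_nonneg_eq_0_iff)
    ultimately show False using w by linarith
  qed
  then have "f u = m *\<^sub>R u"
    by (simp add: v_def)
  then show ?thesis
    by (rule that[OF uS nu])
qed

text \<open>Split off one eigenvector \<open>u\<close>. Self-adjointness makes the orthogonal complement of \<open>u\<close> in \<open>S\<close>
  invariant again, which is why the induction ranges over all invariant subspaces.\<close>

lemma self_adjoint_orthonormal_eigenbasis:
  fixes f :: "'a::euclidean_space \<Rightarrow> 'a"
  assumes lin: "linear f" and sa: "\<And>x y. f x \<bullet> y = x \<bullet> f y"
    and "subspace S" and "f ` S \<subseteq> S"
  shows "\<exists>B. pairwise orthogonal B \<and> (\<forall>b\<in>B. norm b = 1 \<and> (\<exists>c. f b = c *\<^sub>R b)) \<and> span B = S"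
  using assms(3,4)
proof (induction "dim S" arbitrary: S rule: less_induct)
  case less
  show ?case
  proof (cases "S = {0}")
    case True
    then show ?thesis by (intro exI[of _ "{}"]) auto
  next
    case False
    obtain u c where u: "u \<in> S" "norm u = 1" "f u = c *\<^sub>R u"
      using self_adjoint_eigenvector_exists[OF lin sa less.prems False] by blast
    define S' where "S' = S \<inter> {x. orthogonal u x}"
    have S': "subspace S'"
      unfolding S'_def
      using less.prems(1) subspace_orthogonal_to_vector by (rule subspace_inter)
    have "f ` S' \<subseteq> S'"
    proof clarify
      fix x assume x: "x \<in> S'"
      have "u \<bullet> f x = f u \<bullet> x" by (simp add: sa)
      also have "\<dots> = 0" using x u by (simp add: S'_def orthogonal_def)
      finally show "f x \<in> S'"
        using x less.prems(2) by (auto simp: S'_def orthogonal_def)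
    qed
    moreover have "u \<notin> S'"
      using u by (auto simp: S'_def orthogonal_def dot_square_norm)
    then have "S' \<subset> S" using u by (auto simp: S'_def)
    then have "dim S' < dim S"
      using S' less.prems(1) by (metis dim_psubset span_eq_iff)
    ultimately obtain B where B: "pairwise orthogonal B" "span B = S'"
      "\<forall>b\<in>B. norm b = 1 \<and> (\<exists>c. f b = c *\<^sub>R b)"
      using less.hyps[OF _ S'] by blast
    have BS': "B \<subseteq> S'" using B(2) span_superset by blast
    have "pairwise orthogonal (insert u B)"
      using B(1) BS' by (auto simp: pairwise_insert S'_def orthogonal_commute)
    moreover have "span (insert u B) = S"
    proof
      show "span (insert u B) \<subseteq> S"
        using u BS' less.prems(1) by (intro span_minimal) (auto simp: S'_def)
      show "S \<subseteq> span (insert u B)"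
      proof
        fix x assume x: "x \<in> S"
        have "x - (u \<bullet> x) *\<^sub>R u \<in> S'"
          using x u less.prems(1)
          by (simp add: S'_def subspace_diff subspace_scale orthogonal_def inner_diff_right
              dot_square_norm)
        then show "x \<in> span (insert u B)"
          unfolding span_insert using B(2) by blast
      qed
    qed
    ultimately show ?thesis
      using B(3) u by (intro exI[of _ "insert u B"]) auto
  qed
qed

section \<open>Power sums of the eigenvalues of a symmetric matrix\<close>

lemma symmetric_matrix_diagonalizable:
  fixes A :: "real^'n^'n"
  assumes "transpose A = A"
  obtains Q :: "real^'n^'n" and d where "orthogonal_matrix Q"
    "A = Q ** (\<chi> i j. if i = j then d i else 0) ** transpose Q"
proof -
  have "(A *v x) \<bullet> y = x \<bullet> (A *v y)" for x y
    by (metis assms dot_lmul_matrix transpose_matrix_vector)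
  from self_adjoint_orthonormal_eigenbasis[OF _ this subspace_UNIV]
  obtain B where B: "pairwise orthogonal B" "\<forall>b\<in>B. norm b = 1 \<and> (\<exists>c. A *v b = c *\<^sub>R b)"
    "span B = UNIV"
    by auto
  have "independent B"
    using B by (intro pairwise_orthogonal_independent) auto
  then have "finite B" "card B = CARD('n)"
    using B(3) by (auto simp: independent_imp_finite dim_eq_card_independent[symmetric])
      (metis dim_UNIV dim_eq_card_independent dim_span DIM_cart DIM_real mult_1_right)+
  then obtain h :: "'n \<Rightarrow> _" where h: "bij_betw h UNIV B"
    by (metis finite finite_same_card_bij)
  then have hB: "h i \<in> B" for i by (auto simp: bij_betw_def)
  then have "\<forall>i. \<exists>c. A *v h i = c *\<^sub>R h i"
    using B(2) by blast
  then obtain d where d: "\<And>i. A *v h i = d i *\<^sub>R h i"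
    using choice[of "\<lambda>i c. A *v h i = c *\<^sub>R h i"] by blast
  define P :: "real^'n^'n" where "P = (\<chi> i. h i)"
  define D :: "real^'n^'n" where "D = (\<chi> i j. if i = j then d i else 0)"
  have "h i \<bullet> h j = (if i = j then 1 else 0)" for i j
    using B(1,2) hB[of i] hB[of j] h
    by (auto simp: dot_square_norm pairwise_def orthogonal_def bij_betw_def inj_eq)
  then have PP: "P ** transpose P = mat 1"
    by (simp add: vec_eq_iff P_def matrix_matrix_mult_def transpose_def mat_def inner_vec_def)
  have "(A ** transpose P) $ i $ j = (transpose P ** D) $ i $ j" for i j
    using arg_cong[OF d[of j], of "\<lambda>v. v $ i"]
    by (simp add: P_def D_def matrix_matrix_mult_def matrix_vector_mult_def transpose_def
        if_distrib cong: if_cong)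
  then have AP: "A ** transpose P = transpose P ** D"
    by (simp add: vec_eq_iff)
  have PP': "transpose P ** P = mat 1"
    using PP matrix_left_right_inverse by blast
  have "A = A ** (transpose P ** P)" by (simp add: PP')
  also have "\<dots> = transpose P ** D ** P" by (simp add: matrix_mul_assoc AP)
  finally have "A = transpose P ** D ** transpose (transpose P)" by simp
  moreover have "orthogonal_matrix (transpose P)"
    using PP PP' by (simp add: orthogonal_matrix_def)
  ultimately show ?thesis using that unfolding D_def by blast
qed

lemma const_poly_sum: "[:\<Sum>k\<in>K. g k:] = (\<Sum>k\<in>K. [:g k:])"
proof (induction K rule: infinite_finite_induct)
  case (insert x K)
  have "[:sum g (insert x K):] = [:g x:] + [:sum g K:]"
    using insert.hyps by simp
  then show ?case
    by (simp only: insert.IH sum.insert[OF insert.hyps])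
qed auto

lemma const_poly_matrix_mult:
  "map_matrix (\<lambda>c. [:c:]) (A ** B) = map_matrix (\<lambda>c. [:c:]) A ** map_matrix (\<lambda>c. [:c:]) B"
  for A :: "'a::comm_ring_1^'n^'m" and B :: "'a^'k^'n"
  by (simp add: vec_eq_iff matrix_matrix_mult_def const_poly_sum mult.commute)

lemma matrix_diff_ldistrib: "A ** (B - C) = A ** B - A ** C"
  for A :: "'a::ring_1^'n^'m"
  by (simp add: vec_eq_iff matrix_matrix_mult_def right_diff_distrib sum_subtractf)

lemma matrix_diff_rdistrib: "(A - B) ** C = A ** C - B ** C"
  for A :: "'a::ring_1^'n^'m"
  by (simp add: vec_eq_iff matrix_matrix_mult_def left_diff_distrib sum_subtractf)

text \<open>\<open>P\<close> also conjugates \<open>X I - D\<close> to \<open>X I - A\<close> over the polynomial ring, where its determinant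
  is still a unit and can be cancelled.\<close>

lemma charpoly_similar:
  fixes A D P Q :: "'a::comm_ring_1^'n^'n"
  assumes "A ** P = P ** D" and "P ** Q = mat 1"
  shows "charpoly A = charpoly D"
proof -
  let ?m = "map_matrix (\<lambda>c::'a. [:c:]) :: 'a^'n^'n \<Rightarrow> _"
  let ?X = "mat [:0, 1:] :: 'a poly^'n^'n"
  have "(?X - ?m A) ** ?m P = ?X ** ?m P - ?m (A ** P)"
    by (simp add: const_poly_matrix_mult matrix_diff_rdistrib)
  also have "?X ** ?m P = ?m P ** ?X"
    by (simp add: vec_eq_iff matrix_matrix_mult_def mat_def if_distrib if_distribR mult.commute
        cong: if_cong)
  also have "?m P ** ?X - ?m (A ** P) = ?m P ** (?X - ?m D)"
    unfolding assms(1)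
    by (simp add: const_poly_matrix_mult matrix_diff_ldistrib)
  finally have 1: "det (?X - ?m A) * det (?m P) = det (?m P) * det (?X - ?m D)"
    by (metis det_mul)
  have "?m P ** ?m Q = ?m (mat 1)"
    by (simp add: assms(2) flip: const_poly_matrix_mult)
  also have "\<dots> = mat 1"
    by (simp add: vec_eq_iff mat_def)
  finally have 2: "det (?m P) * det (?m Q) = 1"
    by (metis det_mul det_I)
  have "det (?X - ?m A) = det (?X - ?m A) * det (?m P) * det (?m Q)"
    by (simp add: 2 mult.assoc)
  also have "\<dots> = det (?X - ?m D) * (det (?m P) * det (?m Q))"
    by (simp only: 1 mult.commute[of "det (?m P)"] mult.assoc)
  finally show ?thesis
    by (simp add: charpoly_def 2)
qed

lemma eigenvalues_diagonal:
  "eigenvalues (\<chi> i j. if i = j then d i else 0 :: real^'n^'n) = image_mset d (mset_set UNIV)"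
proof -
  have "charpoly (\<chi> i j. if i = j then d i else 0 :: real^'n^'n) = (\<Prod>i\<in>UNIV. [:- d i, 1:])"
    unfolding charpoly_def
    by (subst det_diagonal) (auto simp: mat_def)
  then show ?thesis
    by (simp add: eigenvalues_def proots_prod sum_unfold_sum_mset)
qed

lemma symmetric_matrix_eigenvalue_sums:
  fixes A :: "real^'n^'n"
  assumes "transpose A = A"
  shows "(\<Sum>x\<in>#eigenvalues A. x) = trace A"
    and "(\<Sum>x\<in>#eigenvalues A. x\<^sup>2) = trace (A ** A)"
proof -
  obtain Q :: "real^'n^'n" and d where Q: "orthogonal_matrix Q"
    and A: "A = Q ** (\<chi> i j. if i = j then d i else 0) ** transpose Q"
    using symmetric_matrix_diagonalizable[OF assms] by blast
  define D :: "real^'n^'n" where "D = (\<chi> i j. if i = j then d i else 0)"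
  have QQ: "transpose Q ** Q = mat 1" "Q ** transpose Q = mat 1"
    using Q by (auto simp: orthogonal_matrix_def)
  have AD: "A = Q ** D ** transpose Q" by (simp add: A D_def)
  have AQ: "A ** Q = Q ** D"
    by (simp add: AD QQ flip: matrix_mul_assoc)
  have "charpoly A = charpoly D"
    using AQ QQ(2) by (rule charpoly_similar)
  then have E: "eigenvalues A = image_mset d (mset_set UNIV)"
    using eigenvalues_diagonal[of d] by (simp add: eigenvalues_def D_def)
  have tr: "trace (Q ** M ** transpose Q) = trace M" for M :: "real^'n^'n"
    by (metis QQ(1) matrix_mul_assoc matrix_mul_rid trace_mul_sym)
  show "(\<Sum>x\<in>#eigenvalues A. x) = trace A"
    unfolding E by (simp add: AD tr) (simp add: trace_def D_def sum_unfold_sum_mset)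
  have "(D ** D) $ i $ j = (if i = j then (d i)\<^sup>2 else 0)" for i j
  proof -
    have "(D ** D) $ i $ j = (\<Sum>k\<in>UNIV. if k = i then d i * D $ i $ j else 0)"
      unfolding matrix_matrix_mult_def vec_lambda_beta by (rule sum.cong) (auto simp: D_def)
    then show ?thesis
      by (simp add: D_def power2_eq_square)
  qed
  then have DD: "trace (D ** D) = (\<Sum>i\<in>UNIV. (d i)\<^sup>2)"
    by (simp add: trace_def)
  have "A ** A = Q ** (D ** D) ** transpose Q"
    by (metis AD AQ matrix_mul_assoc)
  then have "trace (A ** A) = trace (D ** D)"
    by (simp add: tr)
  then show "(\<Sum>x\<in>#eigenvalues A. x\<^sup>2) = trace (A ** A)"
    unfolding E
    by (simp add: DD multiset.map_comp comp_def sum_unfold_sum_mset)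
qed

section \<open>Gram matrices of pentatopes\<close>

lemma vector_4 [simp]:
  "(vector [x, y, z, w] :: 'a::zero^4) $ 1 = x"
  "(vector [x, y, z, w] :: 'a::zero^4) $ 2 = y"
  "(vector [x, y, z, w] :: 'a::zero^4) $ 3 = z"
  "(vector [x, y, z, w] :: 'a::zero^4) $ 4 = w"
  unfolding vector_def by simp_all

text \<open>A convex set is a null set only if its interior is empty, and the convex hull of five
  affinely independent points in dimension four has an interior.\<close>

lemma pentatope_hypervolume_pos:
  assumes "pentatope p"
  shows "hypervolume p > 0"
proof -
  let ?C = "convex hull (p ` {1..5})"
  have "card (p ` {1..5}) = Suc DIM(real^4)"
    using assms by (simp add: pentatope_def card_image)
  then have "interior ?C \<noteq> {}"
    using assms interior_convex_hull_eq_empty[of "p ` {1..5}"] by (simp add: pentatope_def)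
  then have "\<not> negligible ?C"
    by (simp add: negligible_convex_interior)
  moreover have "?C \<in> lmeasurable"
    by (intro lmeasurable_compact finite_imp_compact_convex_hull) auto
  ultimately show ?thesis
    unfolding hypervolume_def
    by (metis measure_nonneg negligible_iff_measure order_less_le)
qed

definition edge_gram :: "(nat \<Rightarrow> real^4) \<Rightarrow> real^4^4" where
  "edge_gram p = transpose (edge_matrix p) ** edge_matrix p"

lemma edge_gram_nth:
  "edge_gram p $ i $ j =
     vector [p 2 - p 1, p 3 - p 1, p 4 - p 1, p 5 - p 1] $ i \<bullet>
     (vector [p 2 - p 1, p 3 - p 1, p 4 - p 1, p 5 - p 1] :: real^4^4) $ j"
  by (simp add: edge_gram_def edge_matrix_def matrix_matrix_mult_def transpose_def inner_vec_def)

text \<open>The inverse of the Gram matrix of the regular pentatope whose edges have length \<open>sqrt 2\<close>; that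
  normalization keeps the entries free of \<open>a\<close>.\<close>

definition regular_gram_inverse :: "real^4^4" where
  "regular_gram_inverse = (\<chi> i j. (if i = j then 1 else 0) - 1 / 5)"

lemma edge_gram_regular:
  "edge_gram (regular_pentatope a) = (\<chi> i j. if i = j then a\<^sup>2 else a\<^sup>2 / 2)"
  unfolding vec_eq_iff forall_4 edge_gram_nth
  by (simp add: regular_pentatope_def inner_vec_def sum_4 field_simps power2_eq_square
      flip: real_sqrt_mult)

lemma regular_gram_inverse:
  assumes "a \<noteq> 0"
  shows "((2 / a\<^sup>2) *\<^sub>R regular_gram_inverse) ** edge_gram (regular_pentatope a) = mat 1"
  unfolding edge_gram_regular regular_gram_inverse_def vec_eq_iff forall_4
  using assms by (simp add: matrix_matrix_mult_def mat_def sum_4 field_simps)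

text \<open>Both traces see \<open>R\<close> only through \<open>B\<close>: cyclic permutation brings the factors
  \<open>matrix_inv R\<close> and \<open>transpose (matrix_inv R)\<close> next to each other, and their product is \<open>B\<close>.\<close>

lemma
  fixes R T :: "real^'n^'n"
  assumes B: "B ** (transpose R ** R) = mat 1"
  defines "A \<equiv> transpose (matrix_inv R) ** transpose T ** T ** matrix_inv R"
  shows trace_comparison: "trace A = trace (B ** (transpose T ** T))"
    and trace_comparison_square:
      "trace (A ** A) = trace (B ** (transpose T ** T) ** (B ** (transpose T ** T)))"
proof -
  define N where "N = matrix_inv R"
  define G where "G = transpose T ** T"
  have "\<exists>N. R ** N = mat 1 \<and> N ** R = mat 1"
    using B by (metis matrix_left_right_inverse matrix_mul_assoc)
  then have N: "R ** N = mat 1" "N ** R = mat 1"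
    unfolding N_def matrix_inv_def by (metis (mono_tags, lifting) someI_ex)+
  have "transpose R ** transpose N = mat 1"
    by (metis N(2) matrix_transpose_mul transpose_mat)
  moreover have "B ** transpose R = N"
    by (metis B N(1) matrix_mul_assoc matrix_mul_lid matrix_mul_rid)
  ultimately have NN: "N ** transpose N = B"
    by (metis matrix_mul_assoc matrix_mul_rid)
  have A: "A = transpose N ** G ** N"
    by (simp add: A_def N_def G_def matrix_mul_assoc)
  have "trace A = trace (N ** (transpose N ** G))"
    unfolding A by (rule trace_mul_sym)
  then show "trace A = trace (B ** (transpose T ** T))"
    by (simp add: matrix_mul_assoc NN flip: G_def)
  have AA: "A ** A = (transpose N ** G ** N ** transpose N ** G) ** N"
    by (simp add: A matrix_mul_assoc)
  have "trace (A ** A) = trace (N ** (transpose N ** G ** N ** transpose N ** G))"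
    unfolding AA by (rule trace_mul_sym)
  also have "\<dots> = trace ((N ** transpose N) ** G ** ((N ** transpose N) ** G))"
    by (simp only: matrix_mul_assoc)
  finally show "trace (A ** A) = trace (B ** (transpose T ** T) ** (B ** (transpose T ** T)))"
    by (simp only: NN G_def)
qed

lemma inner_eq_norms: "x \<bullet> y = ((norm x)\<^sup>2 + (norm y)\<^sup>2 - (norm (y - x))\<^sup>2) / 2"
  for x y :: "'a::real_inner"
  by (simp add: power2_norm_eq_inner inner_diff inner_commute)

text \<open>Polarization: the squared length of the edge between two vertices other than \<open>p 1\<close> is that of
  the difference of the two edge vectors from \<open>p 1\<close>.\<close>

lemma edge_gram_edge_length:
  fixes p :: "nat \<Rightarrow> real^4"
  defines "s \<equiv> \<lambda>i. (edge_length p i)\<^sup>2"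
  defines "G \<equiv> edge_gram p"
  shows "G$1$1 = s 1" "G$2$2 = s 2" "G$3$3 = s 3" "G$4$4 = s 4"
    "G$1$2 = (s 1 + s 2 - s 5) / 2" "G$2$1 = (s 1 + s 2 - s 5) / 2"
    "G$1$3 = (s 1 + s 3 - s 6) / 2" "G$3$1 = (s 1 + s 3 - s 6) / 2"
    "G$1$4 = (s 1 + s 4 - s 7) / 2" "G$4$1 = (s 1 + s 4 - s 7) / 2"
    "G$2$3 = (s 2 + s 3 - s 8) / 2" "G$3$2 = (s 2 + s 3 - s 8) / 2"
    "G$2$4 = (s 2 + s 4 - s 9) / 2" "G$4$2 = (s 2 + s 4 - s 9) / 2"
    "G$3$4 = (s 3 + s 4 - s 10) / 2" "G$4$3 = (s 3 + s 4 - s 10) / 2"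
  by (simp_all add: G_def edge_gram_nth inner_eq_norms s_def edge_length_def norm_minus_commute)

lemma sum_1_10: "(\<Sum>i = 1..10. f i) =
   f 1 + f 2 + f 3 + f 4 + f 5 + f 6 + f 7 + f 8 + f 9 + f (10::nat)"
  for f :: "nat \<Rightarrow> real"
  by (simp add: eval_nat_numeral)

lemma trace_regular_gram_inverse_edge_gram:
  "trace (regular_gram_inverse ** edge_gram p) = (\<Sum>i = 1..10. (edge_length p i)\<^sup>2) / 5"
  unfolding sum_1_10
  by (simp add: trace_def matrix_matrix_mult_def sum_4 regular_gram_inverse_def
      edge_gram_edge_length field_simps)

text \<open>The ten squares of \<open>Theta\<close> are one representation of the quadratic form
  \<open>trace (B G B G)\<close> as a sum of squares. For the regular pentatope with edge length 1 both sides
  are 3600, as \<open>B G\<close> is then half the identity.\<close>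

lemma Theta_eq_trace:
  "Theta (\<lambda>i. (edge_length p i)\<^sup>2) =
     3600 * trace (regular_gram_inverse ** edge_gram p ** (regular_gram_inverse ** edge_gram p))"
  unfolding Theta_def
  by (simp add: trace_def matrix_matrix_mult_def sum_4 regular_gram_inverse_def
      edge_gram_edge_length) algebra

section \<open>The quality formula\<close>

theorem corollary6p2:
  fixes p :: "nat \<Rightarrow> real^4" and l :: "nat \<Rightarrow> real"
  assumes "pentatope p"
    and "\<And>i. i \<in> {1..10} \<Longrightarrow> l i = edge_length p i"
  shows "quality p = 6 * (\<Sum>i = 1..10. (l i)\<^sup>2) / sqrt (Theta (\<lambda>i. (l i)\<^sup>2))"
proof -
  define a where "a = root 4 (96 * hypervolume p / sqrt 5)"
  define c where "c = 2 / a\<^sup>2"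
  define M where "M = regular_gram_inverse ** edge_gram p"
  define A where "A = comparison_matrix p"
  have a: "a > 0"
    using pentatope_hypervolume_pos[OF assms(1)] by (simp add: a_def)
  then have c: "c > 0" by (simp add: c_def)
  let ?R = "edge_matrix (regular_pentatope a)" and ?T = "edge_matrix p"
  have A: "A = transpose (matrix_inv ?R) ** transpose ?T ** ?T ** matrix_inv ?R"
    by (simp add: A_def comparison_matrix_def a_def Let_def)
  have inv: "(c *\<^sub>R regular_gram_inverse) ** (transpose ?R ** ?R) = mat 1"
    using regular_gram_inverse[of a] a by (simp add: c_def edge_gram_def)
  have cM: "(c *\<^sub>R regular_gram_inverse) ** (transpose ?T ** ?T) = c *\<^sub>R M"
    by (simp add: M_def edge_gram_def scalar_matrix_assoc)
  have "transpose A = A"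
    by (simp add: A matrix_transpose_mul matrix_mul_assoc)
  note sums = symmetric_matrix_eigenvalue_sums[OF this]
  have "trace A = c * trace M"
    using trace_comparison[OF inv, of ?T] unfolding cM A[symmetric]
    by (simp add: trace_def sum_distrib_left)
  moreover have "trace (A ** A) = c\<^sup>2 * trace (M ** M)"
    using trace_comparison_square[OF inv, of ?T] unfolding cM A[symmetric]
    by (simp add: trace_def sum_distrib_left matrix_matrix_mult_def power2_eq_square ac_simps)
  ultimately have "quality p = c * trace M / (2 * sqrt (c\<^sup>2 * trace (M ** M)))"
    using sums by (simp add: quality_def A_def)
  also have "\<dots> = trace M / (2 * sqrt (trace (M ** M)))"
    using c by (simp add: real_sqrt_mult)
  also have "trace M = (\<Sum>i = 1..10. (edge_length p i)\<^sup>2) / 5"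
    unfolding M_def by (rule trace_regular_gram_inverse_edge_gram)
  also have "(\<Sum>i = 1..10. (edge_length p i)\<^sup>2) = (\<Sum>i = 1..10. (l i)\<^sup>2)"
    using assms(2) by simp
  also have "trace (M ** M) = Theta (\<lambda>i. (edge_length p i)\<^sup>2) / 3600"
    by (simp add: M_def Theta_eq_trace)
  also have "Theta (\<lambda>i. (edge_length p i)\<^sup>2) = Theta (\<lambda>i. (l i)\<^sup>2)"
    using assms(2) by (simp add: Theta_def)
  also have "sqrt (Theta (\<lambda>i. (l i)\<^sup>2) / 3600) = sqrt (Theta (\<lambda>i. (l i)\<^sup>2)) / 60"
    by (simp add: real_sqrt_divide)
  finally show ?thesis by simp
qed

end
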